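(* Let $P,Q$ be Borel probability measures on $\mathbb{R}$ with cumulative distribution functions $F$ and $G$, respectively. Then the optimal transport cost $$T(P,Q):=\min_{\gamma\in\Pi(P,Q)}\int_{\mathbb{R}^2} I_{\{y>x\}}\,\mathrm d\gamma(x,y)$$ admits the one-dimensional representation $$T(P,Q)=\max_{a\in\mathbb{R}}\bigl[F(a)-G(a)\bigr].$$
   Context: $\Pi(P,Q)$ denotes the set of couplings of $P$ and $Q$, i.e. Borel probability measures $\gamma$ on $\mathbb{R}^2$ whose first marginal (the law of the coordinate $x$) is $P$ and whose second marginal (the law of the coordinate $y$) is $Q$. $I_{\{y>x\}}$ is the indicator function of the set $\{(x,y)\in\mathbb{R}^2: y>x\}$. Cumulative distribution functions are $F(a)=P((-\infty,a])$ and $G(a)=Q((-\infty,a])$.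
   Formalization: The maximum over a of F(a)−G(a) is replaced by the supremum, since it need not be attained: for P uniform on [0,1] and Q the point mass at 1, T(P,Q)=1 but F(a)−G(a)<1 for every a. *)

theory Defs
  imports "HOL-Probability.Probability"
begin

definition couplings :: "real measure \<Rightarrow> real measure \<Rightarrow> (real \<times> real) measure set" where
  "couplings P Q = {\<gamma>. prob_space \<gamma> \<and> sets \<gamma> = sets borel \<and>
     distr \<gamma> borel fst = P \<and> distr \<gamma> borel snd = Q}"

definition exceed_cost :: "(real \<times> real) measure \<Rightarrow> real" where
  "exceed_cost \<gamma> = (LINT z|\<gamma>. indicator {(x, y). y > x} z)"

(* Defined as an infimum; that it is a minimum is part of the theorem. The costs
   lie in [0,1], so the infimum is the true one as soon as a coupling exists. *)
definition transport_cost :: "real measure \<Rightarrow> real measure \<Rightarrow> real" where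
  "transport_cost P Q = (INF \<gamma>\<in>couplings P Q. exceed_cost \<gamma>)"

end

theory Submission
  imports Defs
begin

text \<open>
  The easy inequality holds level by level: if \<open>x \<le> a\<close> and not \<open>y \<le> a\<close>, then \<open>y > x\<close>, so every
  coupling charges the event \<open>y > x\<close> with at least \<open>F a - G a\<close>.

  For the converse, let \<open>s\<close> be the supremum of \<open>F - G\<close>, so that \<open>F \<le> G + s\<close> everywhere. Draw \<open>u\<close>
  uniformly from the unit interval and set \<open>x = F\<inverse>(u)\<close> (the quantile function). If \<open>u > s\<close>, then
  \<open>u \<le> F x \<le> G x + s\<close>, that is, \<open>u - s \<le> G x\<close>, and hence \<open>G\<inverse>(u - s) \<le> x\<close>. So the choice
  \<open>y = G\<inverse>(u - s)\<close> incurs no cost as long as \<open>u > s\<close>. To make it a choice for all \<open>u\<close> without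
  changing the law of \<open>y\<close>, read \<open>u - s\<close> modulo 1: rotations of the circle preserve the uniform
  measure, so \<open>(x, y)\<close> is a coupling, and it can only incur a cost on the event \<open>u \<le> s\<close>, which has
  probability \<open>s\<close>. This coupling attains the lower bound, and so it is a minimiser.
\<close>

lemma exceed_event_borel: "{(x, y). y > x} \<in> sets (borel :: (real \<times> real) measure)"
proof -
  have "open {z :: real \<times> real. fst z < snd z}"
    by (intro open_Collect_less continuous_intros)
  then show ?thesis
    by (simp add: case_prod_unfold borel_open)
qed

lemma exceed_cost_eq_prob:
  assumes "sets \<gamma> = sets (borel :: (real \<times> real) measure)"
  shows "exceed_cost \<gamma> = measure \<gamma> {(x, y). y > x}"
proof -
  have "space \<gamma> = UNIV"
    using sets_eq_imp_space_eq[OF assms] by simp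
  then show ?thesis
    by (simp add: exceed_cost_def)
qed

lemma cdf_diff_le_exceed_cost:
  assumes "\<gamma> \<in> couplings P Q"
  shows "cdf P a - cdf Q a \<le> exceed_cost \<gamma>"
proof -
  from assms interpret prob_space \<gamma>
    by (simp add: couplings_def)
  from assms have sets_\<gamma>: "sets \<gamma> = sets (borel :: (real \<times> real) measure)"
    and P: "P = distr \<gamma> borel fst" and Q: "Q = distr \<gamma> borel snd"
    by (auto simp: couplings_def)
  have space_\<gamma>: "space \<gamma> = UNIV"
    using sets_eq_imp_space_eq[OF sets_\<gamma>] by simp
  have fst_meas: "fst \<in> \<gamma> \<rightarrow>\<^sub>M (borel :: real measure)"
    and snd_meas: "snd \<in> \<gamma> \<rightarrow>\<^sub>M (borel :: real measure)"
    by (simp_all add: measurable_cong_sets[OF sets_\<gamma> refl] flip: borel_prod)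
  have cdf_P: "cdf P a = prob (fst -` {..a})" and cdf_Q: "cdf Q a = prob (snd -` {..a})"
    by (simp_all add: P Q cdf_def measure_distr fst_meas snd_meas space_\<gamma>)
  have ev: "fst -` {..a} \<in> events" "snd -` {..a} \<in> events"
    using measurable_sets[OF fst_meas, of "{..a}"] measurable_sets[OF snd_meas, of "{..a}"]
    by (simp_all add: space_\<gamma>)
  have exceed_ev: "{(x, y). y > x} \<in> events"
    by (simp add: sets_\<gamma> exceed_event_borel)
  have "cdf P a \<le> prob (snd -` {..a} \<union> {(x, y). y > x})"
    unfolding cdf_P using ev exceed_ev by (intro finite_measure_mono) auto
  also have "\<dots> \<le> cdf Q a + exceed_cost \<gamma>"
    unfolding cdf_Q exceed_cost_eq_prob[OF sets_\<gamma>]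
    using ev exceed_ev by (intro measure_Un_le) auto
  finally show ?thesis
    by simp
qed

abbreviation uniform01 :: "real measure" where
  "uniform01 \<equiv> restrict_space lborel {0<..<1}"

lemma prob_space_uniform01: "prob_space uniform01"
  by (auto simp: space_restrict_space emeasure_restrict_space intro!: prob_spaceI)

text \<open>
  The rotation of the circle by \<open>-s\<close>, in the coordinate \<open>{0<..<1}\<close>. The point \<open>s\<close>, whose image
  would be the missing endpoint, is kept fixed, so that the quantile functions are only ever
  evaluated at levels strictly between 0 and 1.
\<close>

definition rotate01 :: "real \<Rightarrow> real \<Rightarrow> real" where
  "rotate01 s u = (if u < s then u + 1 - s else if s < u then u - s else u)"

lemma rotate01_in:
  assumes "0 \<le> s" "s \<le> 1" "u \<in> {0<..<1}"
  shows "rotate01 s u \<in> {0<..<1}"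
  using assms by (auto simp: rotate01_def)

lemma measurable_rotate01:
  assumes "0 \<le> s" "s \<le> 1"
  shows "rotate01 s \<in> uniform01 \<rightarrow>\<^sub>M uniform01"
proof (rule measurable_restrict_space2)
  show "rotate01 s \<in> space uniform01 \<rightarrow> {0<..<1}"
    using rotate01_in[OF assms] by (auto simp: space_restrict_space)
  have "rotate01 s \<in> borel \<rightarrow>\<^sub>M borel"
    unfolding rotate01_def by measurable
  then show "rotate01 s \<in> uniform01 \<rightarrow>\<^sub>M lborel"
    by (intro measurable_restrict_space1) simp
qed

lemma emeasure_lborel_vimage_plus:
  fixes c :: real
  assumes "A \<in> sets borel"
  shows "emeasure lborel ((+) c -` A) = emeasure lborel A"
proof -
  have "emeasure (distr lborel borel ((+) c)) A = emeasure lborel ((+) c -` A)"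
    using assms by (subst emeasure_distr) simp_all
  then show ?thesis
    by (simp add: lborel_distr_plus)
qed

text \<open>
  Up to the null sets \<open>{s}\<close> and \<open>{1 - s}\<close>, the rotation exchanges two intervals by translating
  each of them, so the claim reduces to the translation invariance of Lebesgue measure.
\<close>

lemma distr_rotate01:
  assumes s: "0 \<le> s" "s \<le> 1"
  shows "distr uniform01 uniform01 (rotate01 s) = uniform01"
proof (rule measure_eqI)
  fix A assume "A \<in> sets (distr uniform01 uniform01 (rotate01 s))"
  then have A_U: "A \<in> sets uniform01" and A[measurable]: "A \<in> sets borel" and A_sub: "A \<subseteq> {0<..<1}"
    by (auto simp: sets_restrict_space_iff)
  let ?V = "rotate01 s -` A \<inter> {0<..<1}"
  define L where "L = (+) (1 - s) -` (A \<inter> {1 - s<..<1})"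
  define R where "R = (+) (- s) -` (A \<inter> {0<..<1 - s})"
  have plus_meas: "(+) c \<in> borel \<rightarrow>\<^sub>M borel" for c :: real
    by measurable
  have LR: "L \<in> sets borel" "R \<in> sets borel"
    unfolding L_def R_def
    using measurable_sets[OF plus_meas, of "A \<inter> {1 - s<..<1}"]
      measurable_sets[OF plus_meas, of "A \<inter> {0<..<1 - s}"] by auto
  have V: "?V \<in> sets borel"
    using measurable_sets[OF measurable_rotate01[OF s] A_U]
    by (auto simp: sets_restrict_space_iff space_restrict_space)
  have V_mem: "u \<in> ?V \<longleftrightarrow> u \<in> L \<union> R" if "u \<noteq> s" for u
    using that A_sub s by (auto simp: L_def R_def rotate01_def algebra_simps)
  have "emeasure (distr uniform01 uniform01 (rotate01 s)) A = emeasure lborel ?V"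
    using A_U by (simp add: emeasure_distr measurable_rotate01[OF s] space_restrict_space
        emeasure_restrict_space)
  also have "\<dots> = emeasure lborel (L \<union> R)"
    using V LR AE_lborel_singleton[of s] V_mem by (intro emeasure_eq_AE) auto
  also have "\<dots> = emeasure lborel L + emeasure lborel R"
    using LR by (intro plus_emeasure[symmetric]) (auto simp: L_def R_def)
  also have "\<dots> = emeasure lborel (A \<inter> {1 - s<..<1}) + emeasure lborel (A \<inter> {0<..<1 - s})"
    unfolding L_def R_def by (subst (1 2) emeasure_lborel_vimage_plus) simp_all
  also have "\<dots> = emeasure lborel ((A \<inter> {1 - s<..<1}) \<union> (A \<inter> {0<..<1 - s}))"
    by (intro plus_emeasure) auto
  also have "\<dots> = emeasure lborel A"
    using AE_lborel_singleton[of "1 - s"] A_sub s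
    by (intro emeasure_eq_AE) (auto elim!: eventually_mono)
  also have "\<dots> = emeasure uniform01 A"
    using A_sub by (simp add: emeasure_restrict_space)
  finally show "emeasure (distr uniform01 uniform01 (rotate01 s)) A = emeasure uniform01 A" .
qed simp

text \<open>
  The rotated quantile coupling. The bound on the cost comes from the Galois connection
  \<open>u \<le> F x \<longleftrightarrow> F\<inverse>(u) \<le> x\<close>, used once for each of the two marginals.
\<close>

lemma exists_coupling_exceed_cost_le:
  assumes "real_distribution P" "real_distribution Q"
    and s: "0 \<le> s" "s \<le> 1" and le: "\<And>a. cdf P a \<le> cdf Q a + s"
  shows "\<exists>\<gamma>\<in>couplings P Q. exceed_cost \<gamma> \<le> s"
proof -
  interpret P: cdf_distribution P
    using assms(1) by (simp add: cdf_distribution_def)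
  interpret Q: cdf_distribution Q
    using assms(2) by (simp add: cdf_distribution_def)
  interpret U: prob_space uniform01
    by (rule prob_space_uniform01)
  define X where "X = P.I"
  define Y where "Y = (\<lambda>u. Q.I (rotate01 s u))"
  have sets_U: "sets uniform01 = sets (restrict_space borel {0<..<1})"
    by (intro sets_restrict_space_cong) simp
  have X_meas: "X \<in> uniform01 \<rightarrow>\<^sub>M borel"
    unfolding X_def measurable_cong_sets[OF sets_U refl] by (rule P.measurable_CI)
  have IQ_meas: "Q.I \<in> uniform01 \<rightarrow>\<^sub>M borel"
    unfolding measurable_cong_sets[OF sets_U refl] by (rule Q.measurable_CI)
  have Y_meas: "Y \<in> uniform01 \<rightarrow>\<^sub>M borel"
    unfolding Y_def by (rule measurable_compose[OF measurable_rotate01[OF s] IQ_meas])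
  have law_X: "distr uniform01 borel X = P"
    unfolding X_def by (rule P.distr_I_eq_M)
  have "distr uniform01 borel Y = distr (distr uniform01 uniform01 (rotate01 s)) borel Q.I"
    by (simp add: distr_distr[OF IQ_meas measurable_rotate01[OF s]] Y_def comp_def)
  then have law_Y: "distr uniform01 borel Y = Q"
    by (simp add: distr_rotate01[OF s] Q.distr_I_eq_M)

  define \<gamma> where "\<gamma> = distr uniform01 borel (\<lambda>u. (X u, Y u))"
  have XY_meas: "(\<lambda>u. (X u, Y u)) \<in> uniform01 \<rightarrow>\<^sub>M borel"
    using X_meas Y_meas by (rule borel_measurable_Pair)
  have proj_meas: "fst \<in> (borel :: (real \<times> real) measure) \<rightarrow>\<^sub>M borel"
    "snd \<in> (borel :: (real \<times> real) measure) \<rightarrow>\<^sub>M borel"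
    by (simp_all flip: borel_prod)
  have "prob_space \<gamma>"
    unfolding \<gamma>_def using XY_meas by (rule U.prob_space_distr)
  moreover have "distr \<gamma> borel fst = P" "distr \<gamma> borel snd = Q"
    by (simp_all add: \<gamma>_def distr_distr[OF _ XY_meas] proj_meas comp_def law_X law_Y)
  ultimately have coupling: "\<gamma> \<in> couplings P Q"
    by (simp add: couplings_def \<gamma>_def)

  have Y_le_X: "Y u \<le> X u" if u: "u \<in> {0<..<1}" "s < u" for u
  proof -
    have "u \<le> cdf P (X u)"
      using P.pseudoinverse[of u "X u"] u by (simp add: X_def)
    also have "\<dots> \<le> cdf Q (X u) + s"
      by (rule le)
    finally have "rotate01 s u \<le> cdf Q (X u)"
      using u by (simp add: rotate01_def)
    then show ?thesis
      using Q.pseudoinverse[of "rotate01 s u" "X u"] rotate01_in[OF s u(1)] by (simp add: Y_def)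
  qed
  have "exceed_cost \<gamma> = measure uniform01 ({u. X u < Y u} \<inter> {0<..<1})"
    by (subst exceed_cost_eq_prob)
      (simp_all add: \<gamma>_def measure_distr[OF XY_meas exceed_event_borel] space_restrict_space vimage_def)
  also have "\<dots> \<le> measure uniform01 ({0<..s} \<inter> {0<..<1})"
    using Y_le_X by (intro U.finite_measure_mono)
      (auto simp: sets_restrict_space_iff not_less[symmetric])
  also have "\<dots> = measure lborel ({0<..s} \<inter> {0<..<1})"
    by (rule measure_restrict_space) auto
  also have "\<dots> \<le> measure lborel {0<..s}"
    using s by (intro measure_mono_fmeasurable fmeasurableI) auto
  also have "\<dots> = s"
    using s by simp
  finally show ?thesis
    using coupling by blast
qed

theorem proposition2p1:
  fixes P Q :: "real measure"
  assumes "prob_space P" and "sets P = sets borel"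
    and "prob_space Q" and "sets Q = sets borel"
  shows "(\<exists>\<gamma>\<in>couplings P Q. exceed_cost \<gamma> = transport_cost P Q \<and>
            (\<forall>\<gamma>'\<in>couplings P Q. exceed_cost \<gamma> \<le> exceed_cost \<gamma>'))
       \<and> bdd_above (range (\<lambda>a. cdf P a - cdf Q a))
       \<and> transport_cost P Q = (SUP a. cdf P a - cdf Q a)"
proof -
  have distributions: "real_distribution P" "real_distribution Q"
    using assms by (simp_all add: real_distribution_def real_distribution_axioms_def)
  interpret P: real_distribution P
    by fact
  interpret Q: real_distribution Q
    by fact
  define D where "D = (\<lambda>a. cdf P a - cdf Q a)"
  define s where "s = (SUP a. D a)"
  have D_le_1: "D a \<le> 1" for a
    using P.cdf_bounded_prob[of a] Q.cdf_nonneg[of a] by (simp add: D_def)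
  then have bdd: "bdd_above (range D)"
    by (auto intro: bdd_aboveI[where M = 1])
  have D_le_s: "D a \<le> s" for a
    unfolding s_def by (rule cSUP_upper[OF UNIV_I bdd])
  \<comment> \<open>A single value of \<open>D\<close> need not be nonnegative; the supremum is, because of the limit at
    minus infinity.\<close>
  have "(D \<longlongrightarrow> 0 - 0) at_bot"
    unfolding D_def by (intro tendsto_diff P.cdf_lim_at_bot Q.cdf_lim_at_bot)
  then have "0 \<le> s"
    using D_le_s by (auto intro!: tendsto_upperbound[where F = at_bot and f = D])
  moreover have "s \<le> 1"
    unfolding s_def using D_le_1 by (intro cSUP_least) auto
  moreover have "cdf P a \<le> cdf Q a + s" for a
    using D_le_s[of a] by (simp add: D_def)
  ultimately obtain \<gamma> where \<gamma>: "\<gamma> \<in> couplings P Q" "exceed_cost \<gamma> \<le> s"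
    using exists_coupling_exceed_cost_le[OF distributions] by blast
  have s_le: "s \<le> exceed_cost \<gamma>'" if "\<gamma>' \<in> couplings P Q" for \<gamma>'
    unfolding s_def D_def using cdf_diff_le_exceed_cost[OF that] by (intro cSUP_least) auto
  have "exceed_cost \<gamma> = s"
    using \<gamma> s_le by (intro antisym) auto
  moreover have "transport_cost P Q = s"
    unfolding transport_cost_def using \<gamma>(1) \<open>exceed_cost \<gamma> = s\<close> s_le
    by (intro cInf_eq_minimum) auto
  ultimately show ?thesis
    using \<gamma>(1) s_le bdd by (auto simp: s_def D_def)
qed

end
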